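(* Let $f:\mathbb E\to\mathbb R\cup\{+\infty\}$ be a proper extended real function and let $\bar x\in\mathrm{dom}\,f$ be a local minimizer of $f$. Then \[ 0\in\partial^{(1)}_-f(\bar x)\quad\text{and}\quad 0\in\partial^{(n)}_-f(\bar x;\underbrace{0,0,\dots,0}_{(n-1)\text{ times}})\quad\text{for all } n=2,3,4,\dots \]
   Context: $\mathbb E$ is a real finite-dimensional Euclidean space. $L^1(\mathbb E)=L(\mathbb E,\mathbb R)$ is the space of continuous linear functionals on $\mathbb E$ and, for $n>1$, $L^n(\mathbb E)=L(\mathbb E,L^{n-1}(\mathbb E))$. A proper extended real function is $f:\mathbb E\to\mathbb R\cup\{+\infty\}$ having at least one finite value; $\mathrm{dom}\,f=\{x\mid f(x)<+\infty\}$. For $x\in\mathrm{dom}\,f$ and $u\in\mathbb E$, \[ f^{(1)}_-(x;u)=\liminf_{t\downarrow 0,\,u'\to u}t^{-1}[f(x+tu')-f(x)],\qquad \partial^{(1)}_-f(x)=\{x^*\in L^1(\mathbb E)\mid x^*(u)\le f^{(1)}_-(x;u)\ \forall u\in\mathbb E\}. \] Recursively, for $n>1$: given $x^*_i\in\partial^{(i)}_-f(x;x_1^*,\dots,x_{i-1}^* )$ for $i=1,\dots,n-1$ (for $i=1$ this means $x_1^*\in\partial^{(1)}_-f(x)$), the lower Hadamard derivative of order $n$ is \[ f^{(n)}_-(x;x_1^*,\dots,x_{n-1}^*;u)=\liminf_{t\downarrow0,\,u'\to u} n!\,t^{-n}\Big[f(x+tu')-f(x)-\sum_{i=1}^{n-1}\frac{t^i}{i!}\,x_i^*\underbrace{(u')\cdots(u')}_{i\text{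 times}}\Big]\in[-\infty,+\infty], \] and it is defined only for such $x_i^*$. The lower Hadamard subdifferential of order $n$ is \[ \partial^{(n)}_-f(x;x_1^*,\dots,x_{n-1}^* )=\{x^*\in L^n(\mathbb E)\mid x^*\underbrace{(u)\cdots(u)}_{n\text{ times}}\le f^{(n)}_-(x;x_1^*,\dots,x_{n-1}^*;u)\ \forall u\in\mathbb E\}. \] *)

theory Defs
  imports "HOL-Analysis.Analysis"
begin

definition proper_ext :: "('a \<Rightarrow> ereal) \<Rightarrow> bool" where
  "proper_ext f \<longleftrightarrow> (\<forall>x. f x \<noteq> -\<infinity>) \<and> (\<exists>x. f x < \<infinity>)"

definition eff_dom :: "('a \<Rightarrow> ereal) \<Rightarrow> 'a set" where
  "eff_dom f = {x. f x < \<infinity>}"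

definition local_minimizer :: "('a::metric_space \<Rightarrow> ereal) \<Rightarrow> 'a \<Rightarrow> bool" where
  "local_minimizer f x \<longleftrightarrow> (\<exists>\<epsilon>>0. \<forall>y\<in>ball x \<epsilon>. f x \<le> f y)"

text \<open>
  The spaces \<open>L\<^sup>n(E) = L(E, L\<^sup>n\<^sup>-\<^sup>1(E))\<close> would need a different type for every \<open>n\<close>. An
  iterated functional \<open>T\<close> is therefore represented by the function on lists that sends
  \<open>[u\<^sub>1, \<dots>, u\<^sub>n]\<close> to \<open>T(u\<^sub>1)\<dots>(u\<^sub>n)\<close> and every list of another length to \<open>0\<close>; the latter
  makes the representation unique. The value \<open>T(u)\<close> of \<open>T\<close> in \<open>L\<^sup>n\<^sup>-\<^sup>1(E)\<close> is
  \<open>\<lambda>us. T (u # us)\<close>, and the recursion starts from \<open>L\<^sup>0(E) = \<real>\<close>. The zero of every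
  \<open>L\<^sup>n(E)\<close> is \<open>\<lambda>_. 0\<close>.
\<close>

type_synonym 'a iter_functional = "'a list \<Rightarrow> real"

text \<open>
  The operator norm of \<open>L\<^sup>n(E)\<close>, meaningful on the members of \<open>Lspace n\<close> below. As in
  \<open>onorm\<close>, the quotient at \<open>u = 0\<close> is \<open>0\<close>.
\<close>

primrec Lnorm :: "nat \<Rightarrow> 'a::real_normed_vector iter_functional \<Rightarrow> real" where
  "Lnorm 0 T = \<bar>T []\<bar>"
| "Lnorm (Suc n) T = (SUP u. Lnorm n (\<lambda>us. T (u # us)) / norm u)"

text \<open>
  In the successor case the last two conjuncts say that \<open>u \<mapsto> T(u)\<close> is linear, the operations
  of \<open>L\<^sup>n(E)\<close> being pointwise, and bounded, that is, continuous.
\<close>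

primrec Lspace :: "nat \<Rightarrow> 'a::real_normed_vector iter_functional set" where
  "Lspace 0 = {T. \<forall>us. us \<noteq> [] \<longrightarrow> T us = 0}"
| "Lspace (Suc n) = {T. T [] = 0 \<and> (\<forall>u. (\<lambda>us. T (u # us)) \<in> Lspace n) \<and>
     (\<forall>us. linear (\<lambda>u. T (u # us))) \<and>
     (\<exists>K. \<forall>u. Lnorm n (\<lambda>us. T (u # us)) \<le> K * norm u)}"

text \<open>
  The order of the derivative and of the subdifferential is \<open>n = length xs + 1\<close>, where
  \<open>xs = [x\<^sub>1\<^sup>*, \<dots>, x\<^sub>n\<^sub>-\<^sub>1\<^sup>*]\<close>; so \<open>xs = []\<close> gives order one and \<open>x\<^sub>i\<^sup>*\<close> is \<open>xs ! (i - 1)\<close>.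
  In the lower limit, \<open>u'\<close> is allowed to be equal to \<open>u\<close>.
\<close>

definition lower_hadamard_deriv ::
  "('a::real_normed_vector \<Rightarrow> ereal) \<Rightarrow> 'a \<Rightarrow> 'a iter_functional list \<Rightarrow> 'a \<Rightarrow> ereal" where
  "lower_hadamard_deriv f x xs u =
     (let n = Suc (length xs) in
      Liminf (at_right 0 \<times>\<^sub>F nhds u) (\<lambda>(t, u').
        ereal (fact n / t ^ n) *
          (f (x + t *\<^sub>R u') - f x
             - ereal (\<Sum>i = 1..n - 1. t ^ i / fact i * (xs ! (i - 1)) (replicate i u')))))"

definition lower_hadamard_subdiff ::
  "('a::real_normed_vector \<Rightarrow> ereal) \<Rightarrow> 'a \<Rightarrow> 'a iter_functional list \<Rightarrow> 'a iter_functional set" where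
  "lower_hadamard_subdiff f x xs =
     (let n = Suc (length xs) in
      {T \<in> Lspace n. \<forall>u. ereal (T (replicate n u)) \<le> lower_hadamard_deriv f x xs u})"

text \<open>
  The two notions above are total functions here, but mathematically they are defined only if
  each \<open>x\<^sub>i\<^sup>*\<close> belongs to the subdifferential of order \<open>i\<close> at \<open>x\<close> and \<open>x\<^sub>1\<^sup>*, \<dots>, x\<^sub>i\<^sub>-\<^sub>1\<^sup>*\<close>:
\<close>

definition subdiff_admissible ::
  "('a::real_normed_vector \<Rightarrow> ereal) \<Rightarrow> 'a \<Rightarrow> 'a iter_functional list \<Rightarrow> bool" where
  "subdiff_admissible f x xs \<longleftrightarrow>
     (\<forall>i < length xs. xs ! i \<in> lower_hadamard_subdiff f x (take i xs))"

end

theory Submission imports Defs begin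

text \<open>
  Once all earlier functionals vanish, the Taylor sum in the quotient defining the lower Hadamard
  derivative of order \<open>n\<close> vanishes too, and what is left is
  \<open>n! t\<^sup>-\<^sup>n (f (x + t u') - f x)\<close>. As \<open>t\<close> decreases to \<open>0\<close> and \<open>u'\<close> tends to \<open>u\<close>, the point
  \<open>x + t u'\<close> tends to \<open>x\<close>, so it ends up in the ball on which \<open>x\<close> is a minimizer, and the
  quotient is nonnegative there. Hence the lower limit is at least \<open>0\<close>, which is the value of
  the zero functional (\<open>lower_hadamard_deriv_zeros_nonneg\<close>). The bound holds for every
  order separately, so the zeros of lower order are also legitimate arguments of the derivative of
  order \<open>n\<close>. That zero belongs to \<open>L\<^sup>n(E)\<close> rests on its norm being zero
  (\<open>zero_in_Lspace\<close>).
\<close>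

lemma Lnorm_zero: "Lnorm n (\<lambda>_. 0 :: real) = 0"
  by (induction n) simp_all

lemma zero_in_Lspace: "(\<lambda>_. 0) \<in> Lspace n"
proof (induction n)
  case 0
  then show ?case by simp
next
  case (Suc n)
  have "\<exists>K::real. \<forall>u::'a. 0 \<le> K * norm u"
    by (rule exI[of _ 0]) simp
  with Suc show ?case
    by (simp add: Lnorm_zero linear_zero)
qed

text \<open>
  The nearby points \<open>x + t u'\<close> are evaluated along the filter of the Hadamard lower limit, so
  joint continuity of scaling is what transfers a property of neighbourhoods of \<open>x\<close> to it.
\<close>

lemma eventually_hadamard_nearby:
  fixes x u :: "'a::real_normed_vector"
  assumes "eventually P (nhds x)"
  shows "\<forall>\<^sub>F (t, u') in at_right 0 \<times>\<^sub>F nhds u. P (x + t *\<^sub>R u')"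
proof -
  have fst_lim: "(fst \<longlongrightarrow> (0::real)) (at_right 0 \<times>\<^sub>F nhds u)"
    by (rule filterlim_compose[OF _ filterlim_fst]) (rule tendsto_ident_at)
  have snd_lim: "(snd \<longlongrightarrow> u) (at_right (0::real) \<times>\<^sub>F nhds u)"
    by (rule filterlim_snd)
  have "((\<lambda>p. x + fst p *\<^sub>R snd p) \<longlongrightarrow> x + 0 *\<^sub>R u) (at_right 0 \<times>\<^sub>F nhds u)"
    by (intro tendsto_intros fst_lim snd_lim)
  then have "filterlim (\<lambda>p. x + fst p *\<^sub>R snd p) (nhds x) (at_right 0 \<times>\<^sub>F nhds u)"
    by simp
  with assms show ?thesis
    unfolding filterlim_iff by (simp add: case_prod_unfold)
qed

text \<open>
  The lower limit inherits the sign of the quotients, each of which is a positive factor times the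
  increment of \<open>f\<close> from its local minimum.
\<close>

lemma lower_hadamard_deriv_zeros_nonneg:
  fixes f :: "'a::real_normed_vector \<Rightarrow> ereal"
  assumes "local_minimizer f x"
  shows "0 \<le> lower_hadamard_deriv f x (replicate k (\<lambda>_. 0)) u"
proof -
  from assms obtain \<epsilon> where "\<epsilon> > 0" and ball: "\<forall>y\<in>ball x \<epsilon>. f x \<le> f y"
    unfolding local_minimizer_def by blast
  then have "eventually (\<lambda>y. f x \<le> f y) (nhds x)"
    unfolding eventually_nhds by (meson centre_in_ball open_ball)
  then have nearby: "\<forall>\<^sub>F (t, u') in at_right 0 \<times>\<^sub>F nhds u. f x \<le> f (x + t *\<^sub>R u')"
    by (rule eventually_hadamard_nearby)
  have pos: "\<forall>\<^sub>F (t, u') in at_right (0::real) \<times>\<^sub>F nhds u. t > 0"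
    using eventually_prod1[of "nhds u" "\<lambda>t. t > 0" "at_right (0::real)"]
    by (simp add: eventually_at_right_less)
  have taylor: "(\<Sum>i = 1..k. t ^ i / fact i * (replicate k (\<lambda>_. 0) ! (i - 1)) (replicate i u')) = 0"
    for t :: real and u' :: 'a
    by (intro sum.neutral) auto
  show ?thesis
    unfolding lower_hadamard_deriv_def Let_def
  proof (rule Liminf_bounded, use nearby pos in eventually_elim, clarify)
    fix t :: real and u'
    assume "f x \<le> f (x + t *\<^sub>R u')" and "t > 0"
    moreover from this have "0 \<le> f (x + t *\<^sub>R u') - f x"
      by (simp add: ereal_diff_positive)
    ultimately show "0 \<le> ereal (fact (Suc (length (replicate k (\<lambda>_::'a list. 0::real)))) /
          t ^ Suc (length (replicate k (\<lambda>_::'a list. 0::real)))) *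
        (f (x + t *\<^sub>R u') - f x - ereal (\<Sum>i = 1..Suc (length (replicate k (\<lambda>_::'a list. 0::real))) - 1.
          t ^ i / fact i * (replicate k (\<lambda>_. 0) ! (i - 1)) (replicate i u')))"
      using taylor[of t u'] by (simp del: power_Suc fact_Suc flip: zero_ereal_def)
  qed
qed

theorem theorem3p1:
  fixes f :: "'a::euclidean_space \<Rightarrow> ereal" and x :: 'a
  assumes "proper_ext f"
    and "x \<in> eff_dom f"
    and "local_minimizer f x"
  shows "(\<lambda>_. 0) \<in> lower_hadamard_subdiff f x [] \<and>
    (\<forall>n\<ge>2. subdiff_admissible f x (replicate (n - 1) (\<lambda>_. 0)) \<and>
            (\<lambda>_. 0) \<in> lower_hadamard_subdiff f x (replicate (n - 1) (\<lambda>_. 0)))"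
proof -
  from assms(3) have zero: "(\<lambda>_. 0) \<in> lower_hadamard_subdiff f x (replicate k (\<lambda>_. 0))" for k
    using lower_hadamard_deriv_zeros_nonneg[of f x k]
    by (simp add: lower_hadamard_subdiff_def zero_in_Lspace del: Lspace.simps flip: zero_ereal_def)
  show ?thesis
    using zero zero[of 0] by (simp add: subdiff_admissible_def)
qed

end
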